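(* Let $T_1$ and $T_2$ be trees on $n$ vertices, and let $J_1$ and $J_2$ be the cover ideals, in $S=\mathsf{k}[X_1,\dots,X_n]$, of the complement graphs of $T_1$ and $T_2$ respectively. Then the Hilbert series satisfy $H_{J_1^s}(z)=H_{J_2^s}(z)$ for all $s\ge 1$.
   Context: $\mathsf{k}$ is a field and $S=\mathsf{k}[X_1,\dots,X_n]$ has the standard grading; graphs are finite and simple on the vertex set $[n]=\{1,\dots,n\}$. The complement graph $G^c$ of $G$ has the same vertices, and $\{i,j\}$ ($i\ne j$) is an edge of $G^c$ if and only if it is not an edge of $G$. A subset $C\subset[n]$ is a cover set of $G$ if it meets every edge of $G$; it is minimal if $C\setminus\{l\}$ is not a cover set for any $l\in C$. The cover ideal of $G$ is $J(G)=\langle\prod_{i\in C}X_i: C\text{ is a minimal cover set of }G\rangle\subset S$ (an empty product being $1$). For a graded $S$-module $M=\bigoplus_d M_d$, $H_M(z)=\sum_d \dim_{\mathsf{k}}(M_d)z^d$. *)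

theory Defs
  imports
    "HOL-Library.Poly_Mapping"
    "HOL-Computational_Algebra.Formal_Power_Series"
begin

text \<open>
  A graph on the vertex set \<^typ>\<open>'n\<close> is given by its set of edges, each edge being a two-element
  set of vertices. For a finite type \<^typ>\<open>'n\<close> with \<open>n\<close> elements this is a finite simple graph on
  \<open>n\<close> vertices.
\<close>

definition simple_graph :: "'n set set \<Rightarrow> bool" where
  "simple_graph E \<longleftrightarrow> (\<forall>e\<in>E. card e = 2)"

definition connected_graph :: "'n set set \<Rightarrow> bool" where
  "connected_graph E \<longleftrightarrow> (\<forall>u v. (u, v) \<in> {(x, y). {x, y} \<in> E}\<^sup>*)"

text \<open>
  A cycle is listed by its vertices, without repeating the first one at the end; the bound on the
  length excludes walking back and forth along a single edge.
\<close>

definition graph_cycle :: "'n set set \<Rightarrow> 'n list \<Rightarrow> bool" where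
  "graph_cycle E vs \<longleftrightarrow> length vs \<ge> 3 \<and> distinct vs \<and>
     (\<forall>i<length vs. {vs ! i, vs ! (Suc i mod length vs)} \<in> E)"

definition is_tree :: "'n set set \<Rightarrow> bool" where
  "is_tree E \<longleftrightarrow> simple_graph E \<and> connected_graph E \<and> \<not> (\<exists>vs. graph_cycle E vs)"

definition graph_complement :: "'n set set \<Rightarrow> 'n set set" where
  "graph_complement E = {{i, j} | i j. i \<noteq> j \<and> {i, j} \<notin> E}"

definition is_cover :: "'n set set \<Rightarrow> 'n set \<Rightarrow> bool" where
  "is_cover E C \<longleftrightarrow> (\<forall>e\<in>E. C \<inter> e \<noteq> {})"

definition is_minimal_cover :: "'n set set \<Rightarrow> 'n set \<Rightarrow> bool" where
  "is_minimal_cover E C \<longleftrightarrow> is_cover E C \<and> (\<forall>l\<in>C. \<not> is_cover E (C - {l}))"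

text \<open>
  The polynomial ring over \<^typ>\<open>'k\<close> with one variable for each element of \<^typ>\<open>'n\<close>: a polynomial
  maps exponent vectors to coefficients, with finite support.
\<close>

type_synonym ('n, 'k) mpoly = "('n \<Rightarrow>\<^sub>0 nat) \<Rightarrow>\<^sub>0 'k"

definition var :: "'n \<Rightarrow> ('n, 'k::field) mpoly" where
  "var i = Poly_Mapping.single (Poly_Mapping.single i 1) 1"

definition mpoly_scale :: "'k::field \<Rightarrow> ('n, 'k) mpoly \<Rightarrow> ('n, 'k) mpoly" where
  "mpoly_scale c p = Poly_Mapping.single 0 c * p"

text \<open>Ideals are the submodules of the ring regarded as a module over itself.\<close>

definition ideal_generated :: "'r::comm_ring_1 set \<Rightarrow> 'r set" where
  "ideal_generated B = module.span (*) B"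

definition ideal_power :: "'r::comm_ring_1 set \<Rightarrow> nat \<Rightarrow> 'r set" where
  "ideal_power I s = ideal_generated {\<Prod>i<s. f i | f. \<forall>i<s. f i \<in> I}"

definition cover_ideal :: "'n set set \<Rightarrow> ('n, 'k::field) mpoly set" where
  "cover_ideal E = ideal_generated {\<Prod>i\<in>C. var i | C. is_minimal_cover E C}"

definition homogeneous_component :: "('n::finite, 'k::field) mpoly set \<Rightarrow> nat \<Rightarrow> ('n, 'k) mpoly set" where
  "homogeneous_component M d =
     {p \<in> M. \<forall>m\<in>Poly_Mapping.keys p. (\<Sum>i\<in>UNIV. Poly_Mapping.lookup m i) = d}"

text \<open>
  The Hilbert series of a homogeneous ideal, whose components of negative degree vanish.
\<close>

definition hilbert_series :: "('n::finite, 'k::field) mpoly set \<Rightarrow> int fps" where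
  "hilbert_series M =
     Abs_fps (\<lambda>d. int (vector_space.dim mpoly_scale (homogeneous_component M d)))"

lemma module_mult: "module ((*) :: 'r::comm_ring_1 \<Rightarrow> 'r \<Rightarrow> 'r)"
  by unfold_locales (simp_all add: algebra_simps)

lemma vector_space_mpoly_scale:
  "vector_space (mpoly_scale :: 'k::field \<Rightarrow> ('n, 'k) mpoly \<Rightarrow> ('n, 'k) mpoly)"
  by unfold_locales
    (simp_all add: mpoly_scale_def algebra_simps single_add mult_single flip: mult.assoc)

end

theory Submission
  imports Defs "HOL-Library.Multiset" "HOL-Library.Cardinality"
begin

text \<open>
  A set of vertices covers the complement of \<open>T\<close> iff the vertices outside it form a clique of \<open>T\<close>.
  A tree on at least two vertices has no triangle and no isolated vertex, so its maximal cliques are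
  its edges, and \<open>J\<close> is generated by the products of all variables but the two of an edge
  (\<open>minimal_cover_complement_of_tree\<close>). Hence \<open>X\<^sup>m\<close> lies in the monomial ideal \<open>J\<^sup>s\<close> iff there is
  a multiset of \<open>s\<close> edges in which every vertex \<open>w\<close> is missed by at most \<open>m w\<close> edges, and the Hilbert
  function of \<open>J\<^sup>s\<close> counts these exponent vectors \<open>m\<close> by degree.

  The count is computed by deleting a leaf \<open>v\<close> with neighbour \<open>u\<close>, as long as \<open>u\<close> has a further
  neighbour. Every edge but \<open>{u, v}\<close> misses \<open>v\<close>, so \<open>{u, v}\<close> has to be used at least \<open>s - m v\<close> times.
  Using it more often is of no benefit: replacing a surplus copy by another edge at \<open>u\<close> creates a new
  miss at \<open>v\<close> only, where there is room for it. So \<open>{u, v}\<close> may be used exactly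
  \<open>k = max 0 (s - m v)\<close> times. These \<open>k\<close> copies cost \<open>k\<close> at every vertex other than \<open>u\<close> and \<open>v\<close>,
  and what remains is the same problem for the smaller tree and the power \<open>s - k\<close>
  (\<open>admissible_leaf\<close>). The resulting recursion (\<open>leaf_count\<close>) involves the number of vertices, but not
  the shape of the tree. It ends at a single edge, where \<open>J\<close> is the whole ring. Since every tree
  arises from an edge by successively attaching leaves (\<open>tree_leaf_grown\<close>), the Hilbert function
  depends on the number of vertices only. On a single vertex there is just one tree.
\<close>

section \<open>Monomial ideals\<close>

lemma keys_subset_add:
  "Poly_Mapping.keys p \<subseteq> K \<Longrightarrow> Poly_Mapping.keys q \<subseteq> K \<Longrightarrow> Poly_Mapping.keys (p + q) \<subseteq> K"
  by (meson keys_add Un_least order_trans)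

lemma sum_terms_eq_mpoly:
  fixes p :: "'a \<Rightarrow>\<^sub>0 'b::comm_monoid_add"
  shows "(\<Sum>m\<in>Poly_Mapping.keys p. Poly_Mapping.single m (Poly_Mapping.lookup p m)) = p"
proof (rule poly_mapping_eqI)
  fix k
  have "Poly_Mapping.lookup (\<Sum>m\<in>Poly_Mapping.keys p. Poly_Mapping.single m (Poly_Mapping.lookup p m)) k
      = (\<Sum>m\<in>Poly_Mapping.keys p. if m = k then Poly_Mapping.lookup p m else 0)"
    by (simp add: lookup_sum lookup_single when_def)
  also have "\<dots> = Poly_Mapping.lookup p k"
    by (simp add: sum.delta in_keys_iff)
  finally show "Poly_Mapping.lookup (\<Sum>m\<in>Poly_Mapping.keys p. Poly_Mapping.single m (Poly_Mapping.lookup p m)) k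
      = Poly_Mapping.lookup p k" .
qed

lemma ideal_generated_monomials:
  fixes A :: "('n \<Rightarrow>\<^sub>0 nat) set"
  shows "ideal_generated ((\<lambda>a. Poly_Mapping.single a (1::'k::field)) ` A)
       = {p. Poly_Mapping.keys p \<subseteq> {a + b | a b. a \<in> A}}"
proof -
  interpret R: module "(*) :: ('n, 'k) mpoly \<Rightarrow> _" by (rule module_mult)
  let ?U = "{a + b | a b. a \<in> A}"
  have sub: "R.subspace {p. Poly_Mapping.keys p \<subseteq> ?U}"
  proof (rule R.subspaceI)
    fix c p :: "('n, 'k) mpoly"
    assume "p \<in> {p. Poly_Mapping.keys p \<subseteq> ?U}"
    then have p: "Poly_Mapping.keys p \<subseteq> ?U" by simp
    have "Poly_Mapping.keys (c * p) \<subseteq> ?U"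
    proof
      fix m assume "m \<in> Poly_Mapping.keys (c * p)"
      then obtain x y where "m = x + y" "y \<in> Poly_Mapping.keys p" using keys_mult by blast
      moreover then obtain a b where "y = a + b" "a \<in> A" using p by blast
      ultimately have "m = a + (x + b) \<and> a \<in> A" by (simp add: ac_simps)
      then show "m \<in> ?U" by blast
    qed
    then show "c * p \<in> {p. Poly_Mapping.keys p \<subseteq> ?U}" by simp
  qed (simp_all add: keys_subset_add)
  have "Poly_Mapping.single a (1::'k) \<in> {p. Poly_Mapping.keys p \<subseteq> ?U}" if "a \<in> A" for a
  proof -
    have "a = a + 0" by simp
    then have "a \<in> ?U" using that by blast
    then show ?thesis by simp
  qed
  then have monomials: "(\<lambda>a. Poly_Mapping.single a (1::'k)) ` A \<subseteq> {p. Poly_Mapping.keys p \<subseteq> ?U}"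
    by blast
  have le: "R.span ((\<lambda>a. Poly_Mapping.single a 1) ` A) \<subseteq> {p. Poly_Mapping.keys p \<subseteq> ?U}"
    by (rule R.span_minimal[OF monomials sub])
  have ge: "p \<in> R.span ((\<lambda>a. Poly_Mapping.single a 1) ` A)" if p: "Poly_Mapping.keys p \<subseteq> ?U" for p
  proof -
    have "Poly_Mapping.single m (Poly_Mapping.lookup p m) \<in> R.span ((\<lambda>a. Poly_Mapping.single a 1) ` A)"
      if "m \<in> Poly_Mapping.keys p" for m
    proof -
      from that p obtain a b where m: "m = a + b" "a \<in> A" by blast
      have "Poly_Mapping.single m (Poly_Mapping.lookup p m)
          = Poly_Mapping.single b (Poly_Mapping.lookup p m) * Poly_Mapping.single a 1"
        by (simp add: mult_single m add.commute)
      then show ?thesis using m(2) by (simp add: R.span_scale R.span_base)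
    qed
    then show ?thesis
      using R.span_sum[of "Poly_Mapping.keys p" "\<lambda>m. Poly_Mapping.single m (Poly_Mapping.lookup p m)"]
      by (simp only: sum_terms_eq_mpoly)
  qed
  show ?thesis
    unfolding ideal_generated_def
  proof (rule equalityI[OF le], rule subsetI)
    fix p assume "p \<in> {p :: ('n, 'k) mpoly. Poly_Mapping.keys p \<subseteq> ?U}"
    then show "p \<in> R.span ((\<lambda>a. Poly_Mapping.single a 1) ` A)" by (intro ge) simp
  qed
qed

lemma prod_monomials:
  "(\<Prod>i\<in>I. Poly_Mapping.single (f i) (1::'k::comm_semiring_1))
     = Poly_Mapping.single (\<Sum>i\<in>I. f i :: 'a::comm_monoid_add) 1"
  by (induction I rule: infinite_finite_induct) (simp_all add: mult_single)

text \<open>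
  The generators are indexed by \<open>T\<close>, so that a product of \<open>s\<close> of them is recorded by a multiset of
  indices, which will be a multiset of edges.
\<close>

lemma ideal_power_monomials:
  fixes g :: "'e \<Rightarrow> ('n \<Rightarrow>\<^sub>0 nat)"
  shows "ideal_power (ideal_generated ((\<lambda>e. Poly_Mapping.single (g e) (1::'k::field)) ` T)) s
       = {p. Poly_Mapping.keys p \<subseteq> {sum_mset (image_mset g es) + b | es b. set_mset es \<subseteq> T \<and> size es = s}}"
proof -
  interpret R: module "(*) :: ('n, 'k) mpoly \<Rightarrow> _" by (rule module_mult)
  define I where "I = ideal_generated ((\<lambda>e. Poly_Mapping.single (g e) (1::'k)) ` T)"
  define A where "A s = {sum_mset (image_mset g es) | es. set_mset es \<subseteq> T \<and> size es = s}" for s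
  have I_eq: "I = {p. Poly_Mapping.keys p \<subseteq> {a + b | a b. a \<in> g ` T}}"
    unfolding I_def using ideal_generated_monomials[of "g ` T", where 'k='k] by (simp only: image_image)
  have A_eq: "{sum_mset (image_mset g es) + b | es b. set_mset es \<subseteq> T \<and> size es = s}
      = {a + b | a b. a \<in> A s}"
    unfolding A_def by blast
  have keys_prod: "Poly_Mapping.keys (\<Prod>i<s. f i) \<subseteq> {a + b | a b. a \<in> A s}"
    if "\<forall>i<s. f i \<in> I" for f :: "nat \<Rightarrow> ('n, 'k) mpoly" and s
    using that
  proof (induction s)
    case 0
    have "0 \<in> A 0" by (auto simp: A_def)
    then show ?case by simp (metis add.right_neutral)
  next
    case (Suc s)
    show ?case
    proof
      fix m assume "m \<in> Poly_Mapping.keys (\<Prod>i<Suc s. f i)"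
      then obtain x y where m: "m = x + y"
        and x_key: "x \<in> Poly_Mapping.keys (\<Prod>i<s. f i)" and y_key: "y \<in> Poly_Mapping.keys (f s)"
        using keys_mult by fastforce
      have "x \<in> {a + b | a b. a \<in> A s}" using Suc x_key by auto
      then obtain es b where
        x: "x = sum_mset (image_mset g es) + b" "set_mset es \<subseteq> T" "size es = s"
        unfolding A_def by blast
      have "y \<in> {a + b | a b. a \<in> g ` T}" using Suc.prems I_eq y_key by blast
      then obtain e c where y: "y = g e + c" "e \<in> T" by blast
      have "sum_mset (image_mset g (add_mset e es)) \<in> A (Suc s)"
        unfolding A_def using x y by (intro CollectI exI[of _ "add_mset e es"]) simp
      moreover have "m = sum_mset (image_mset g (add_mset e es)) + (b + c)"
        using m x y by (simp add: ac_simps)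
      ultimately show "m \<in> {a + b | a b. a \<in> A (Suc s)}" by blast
    qed
  qed
  have "R.span {\<Prod>i<s. f i | f. \<forall>i<s. f i \<in> I}
      = R.span ((\<lambda>a. Poly_Mapping.single a 1) ` A s)"
  proof (rule R.span_eq[THEN iffD2], rule conjI)
    show "{\<Prod>i<s. f i | f. \<forall>i<s. f i \<in> I} \<subseteq> R.span ((\<lambda>a. Poly_Mapping.single a 1) ` A s)"
      unfolding ideal_generated_monomials[of "A s", where 'k='k, unfolded ideal_generated_def]
    proof
      fix p assume "p \<in> {\<Prod>i<s. f i | f. \<forall>i<s. f i \<in> I}"
      then obtain f where "p = (\<Prod>i<s. f i)" "\<forall>i<s. f i \<in> I" by blast
      then show "p \<in> {p. Poly_Mapping.keys p \<subseteq> {a + b | a b. a \<in> A s}}" using keys_prod by simp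
    qed
  next
    have "Poly_Mapping.single a 1 \<in> {\<Prod>i<s. f i | f. \<forall>i<s. f i \<in> I}" if "a \<in> A s" for a
    proof -
      from that obtain es where es: "a = sum_mset (image_mset g es)" "set_mset es \<subseteq> T" "size es = s"
        unfolding A_def by blast
      obtain xs where xs: "mset xs = es" using ex_mset by blast
      have len: "length xs = s" using es xs by auto
      have "a = sum_list (map g xs)"
        using es(1) xs by (metis mset_map sum_mset_sum_list)
      also have "\<dots> = (\<Sum>i<s. g (xs ! i))"
        by (simp add: sum_list_sum_nth len atLeast0LessThan)
      finally have "Poly_Mapping.single a 1 = (\<Prod>i<s. Poly_Mapping.single (g (xs ! i)) (1::'k))"
        by (simp add: prod_monomials)
      moreover have "Poly_Mapping.single (g (xs ! i)) 1 \<in> I" if "i < s" for i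
        using that es(2) xs len unfolding I_def ideal_generated_def
        by (intro R.span_base) (metis imageI nth_mem set_mset_mset subsetD)
      ultimately show ?thesis by blast
    qed
    then show "(\<lambda>a. Poly_Mapping.single a 1) ` A s \<subseteq> R.span {\<Prod>i<s. f i | f. \<forall>i<s. f i \<in> I}"
      using R.span_superset by blast
  qed
  then have "ideal_power I s = ideal_generated ((\<lambda>a. Poly_Mapping.single a 1) ` A s)"
    by (simp add: ideal_power_def ideal_generated_def)
  then show ?thesis
    unfolding A_eq I_def[symmetric] by (simp only: ideal_generated_monomials)
qed

text \<open>The monomials with exponents in \<open>K\<close> are a basis.\<close>

lemma dim_supported_on:
  fixes K :: "('n \<Rightarrow>\<^sub>0 nat) set"
  assumes "finite K"
  shows "vector_space.dim mpoly_scale {p :: ('n, 'k::field) mpoly. Poly_Mapping.keys p \<subseteq> K} = card K"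
proof -
  interpret V: vector_space "mpoly_scale :: 'k \<Rightarrow> ('n, 'k) mpoly \<Rightarrow> _"
    by (rule vector_space_mpoly_scale)
  let ?x = "\<lambda>m. Poly_Mapping.single m (1::'k)"
  have inj: "inj_on ?x K"
    by (rule inj_onI) (drule arg_cong[where f = Poly_Mapping.keys], simp)
  have scale: "mpoly_scale c (?x m) = Poly_Mapping.single m c" for c and m :: "'n \<Rightarrow>\<^sub>0 nat"
    by (simp add: mpoly_scale_def mult_single)
  show ?thesis
  proof (rule V.dim_unique)
    show "?x ` K \<subseteq> {p. Poly_Mapping.keys p \<subseteq> K}" by auto
    show "card (?x ` K) = card K" by (rule card_image[OF inj])
    show "{p. Poly_Mapping.keys p \<subseteq> K} \<subseteq> V.span (?x ` K)"
    proof
      fix p :: "('n, 'k) mpoly" assume "p \<in> {p. Poly_Mapping.keys p \<subseteq> K}"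
      then have "mpoly_scale (Poly_Mapping.lookup p m) (?x m) \<in> V.span (?x ` K)" if "m \<in> Poly_Mapping.keys p" for m
        using that by (intro V.span_scale V.span_base) auto
      then show "p \<in> V.span (?x ` K)"
        using V.span_sum[of "Poly_Mapping.keys p" "\<lambda>m. mpoly_scale (Poly_Mapping.lookup p m) (?x m)"]
        by (simp only: scale sum_terms_eq_mpoly)
    qed
    show "V.independent (?x ` K)"
    proof
      assume "V.dependent (?x ` K)"
      then obtain u m where m: "m \<in> K" "u (?x m) \<noteq> 0"
        and "(\<Sum>v\<in>?x ` K. mpoly_scale (u v) v) = 0"
        using assms by (auto simp: V.dependent_finite)
      then have "(\<Sum>k\<in>K. Poly_Mapping.single k (u (?x k))) = 0"
        by (simp add: sum.reindex[OF inj] scale)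
      then have "0 = Poly_Mapping.lookup (\<Sum>k\<in>K. Poly_Mapping.single k (u (?x k))) m" by simp
      also have "\<dots> = u (?x m)"
        using m assms by (simp add: lookup_sum lookup_single when_def)
      finally show False using m by simp
    qed
  qed
qed

section \<open>Trees\<close>

text \<open>
  The construction starts from an edge and not from a vertex, because deleting a leaf is only possible
  in the count of exponent vectors if the vertex next to it has another neighbour.
\<close>

inductive leaf_grown :: "'n set \<Rightarrow> 'n set set \<Rightarrow> bool" where
  edge: "a \<noteq> b \<Longrightarrow> leaf_grown {a, b} {{a, b}}"
| leaf: "leaf_grown V E \<Longrightarrow> u \<in> V \<Longrightarrow> v \<notin> V \<Longrightarrow> leaf_grown (insert v V) (insert {u, v} E)"

lemma leaf_grown_edge_subset: "leaf_grown V E \<Longrightarrow> e \<in> E \<Longrightarrow> e \<subseteq> V"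
  by (induction rule: leaf_grown.induct) auto

lemma leaf_grown_no_isolated: "leaf_grown V E \<Longrightarrow> u \<in> V \<Longrightarrow> \<exists>e\<in>E. u \<in> e"
  by (induction rule: leaf_grown.induct) auto

lemma leaf_grown_finite: "leaf_grown V E \<Longrightarrow> finite V"
  by (induction rule: leaf_grown.induct) auto

lemma leaf_grown_simple_path:
  assumes "leaf_grown V E" "a \<in> V" "b \<in> V"
  shows "\<exists>vs. vs \<noteq> [] \<and> hd vs = a \<and> last vs = b \<and> distinct vs \<and> set vs \<subseteq> V
           \<and> successively (\<lambda>x y. {x, y} \<in> E) vs"
  using assms
proof (induction arbitrary: a b rule: leaf_grown.induct)
  case (edge x y)
  show ?case
  proof (cases "a = b")
    case True
    then show ?thesis using edge by (intro exI[of _ "[a]"]) auto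
  next
    case False
    then show ?thesis using edge by (intro exI[of _ "[a, b]"]) auto
  qed
next
  case (leaf V E u v)
  have mono: "successively (\<lambda>x y. {x, y} \<in> insert {u, v} E) vs"
    if "successively (\<lambda>x y. {x, y} \<in> E) vs" for vs
    using that by (rule successively_mono) auto
  consider "a = v" "b = v" | "a = v" "b \<in> V" | "a \<in> V" "b = v" | "a \<in> V" "b \<in> V"
    using leaf.prems by blast
  then show ?case
  proof cases
    case 1
    then show ?thesis by (intro exI[of _ "[v]"]) auto
  next
    case 2
    then obtain vs where "vs \<noteq> []" "hd vs = u" "last vs = b" "distinct vs" "set vs \<subseteq> V"
      "successively (\<lambda>x y. {x, y} \<in> E) vs"
      using leaf.IH[of u b] leaf.hyps by blast
    then show ?thesis using 2 leaf.hyps mono[of vs]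
      by (intro exI[of _ "v # vs"]) (auto simp: successively_Cons insert_commute)
  next
    case 3
    then obtain vs where "vs \<noteq> []" "hd vs = a" "last vs = u" "distinct vs" "set vs \<subseteq> V"
      "successively (\<lambda>x y. {x, y} \<in> E) vs"
      using leaf.IH[of a u] leaf.hyps by blast
    then show ?thesis using 3 leaf.hyps mono[of vs]
      by (intro exI[of _ "vs @ [v]"]) (auto simp: successively_append_iff)
  next
    case 4
    then obtain vs where "vs \<noteq> []" "hd vs = a" "last vs = b" "distinct vs" "set vs \<subseteq> V"
      "successively (\<lambda>x y. {x, y} \<in> E) vs"
      using leaf.IH[of a b] by blast
    then show ?thesis using mono by blast
  qed
qed

lemma graph_cycle_of_path:
  assumes "successively (\<lambda>x y. {x, y} \<in> E) vs" "distinct vs" "length vs \<ge> 2" "y \<notin> set vs"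
    and "{last vs, y} \<in> E" "{y, hd vs} \<in> E"
  shows "graph_cycle E (vs @ [y])"
proof -
  have ne: "vs \<noteq> []" using assms(3) by auto
  have "{(vs @ [y]) ! i, (vs @ [y]) ! (Suc i mod length (vs @ [y]))} \<in> E"
    if "i < length (vs @ [y])" for i
  proof -
    consider "Suc i < length vs" | "Suc i = length vs" | "i = length vs"
      using \<open>i < length (vs @ [y])\<close> by force
    then show ?thesis
    proof cases
      case 1
      then show ?thesis using assms(1) by (simp add: nth_append successively_conv_nth)
    next
      case 2
      then have "last vs = vs ! i" using ne by (metis diff_Suc_1 last_conv_nth)
      then show ?thesis using 2 assms(5) by (simp add: nth_append)
    next
      case 3
      then show ?thesis using assms(6) ne by (simp add: nth_append hd_conv_nth)
    qed
  qed
  then show ?thesis using assms by (simp add: graph_cycle_def)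
qed

lemma connected_graph_crossing_edge:
  assumes "connected_graph E" "u \<in> V" "w \<notin> V"
  obtains x y where "x \<in> V" "y \<notin> V" "{x, y} \<in> E"
proof -
  have "(u, w) \<in> {(x, y). {x, y} \<in> E}\<^sup>*" using assms(1) by (simp add: connected_graph_def)
  then have "w \<in> V \<or> (\<exists>x y. x \<in> V \<and> y \<notin> V \<and> {x, y} \<in> E)"
    by (induction rule: rtrancl_induct) (use assms(2) in auto)
  then show ?thesis using that assms(3) by blast
qed

text \<open>
  By connectedness, a proper nonempty set \<open>V\<close> of vertices has an edge \<open>{x, y}\<close> leaving it. If \<open>y\<close> had
  a second neighbour in \<open>V\<close>, a path inside \<open>V\<close> between the two neighbours would close up to a cycle.
  So \<open>y\<close> is a leaf of the subgraph induced on \<open>V\<close> and \<open>y\<close>.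
\<close>

lemma tree_leaf_grown:
  fixes T :: "'n::finite set set"
  assumes T: "is_tree T" and n: "CARD('n) \<ge> 2"
  shows "leaf_grown UNIV T"
proof -
  have conn: "connected_graph T" and acyc: "\<And>vs. \<not> graph_cycle T vs"
    and two: "\<And>e. e \<in> T \<Longrightarrow> card e = 2"
    using T by (auto simp: is_tree_def simple_graph_def)
  have "\<exists>V. card V = k + 2 \<and> leaf_grown V {e \<in> T. e \<subseteq> V}" if "k + 2 \<le> CARD('n)" for k
    using that
  proof (induction k)
    case 0
    obtain u v :: 'n where "u \<noteq> v"
      using n by (metis One_nat_def UNIV_I card_1_singleton_iff card_le_Suc0_iff_eq finite
          not_less_eq_eq numeral_2_eq_2)
    then obtain y where y: "y \<noteq> u" "{u, y} \<in> T"
      using connected_graph_crossing_edge[OF conn, of u "{u}" v] by auto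
    have "e = {u, y}" if "e \<in> T" "e \<subseteq> {u, y}" for e
      using that y two by (intro card_subset_eq) simp_all
    then have "{e \<in> T. e \<subseteq> {u, y}} = {{u, y}}"
      using y by blast
    then show ?case using y leaf_grown.edge[of u y] by (intro exI[of _ "{u, y}"]) auto
  next
    case (Suc k)
    then obtain V where V: "card V = k + 2" "leaf_grown V {e \<in> T. e \<subseteq> V}" by auto
    have "V \<noteq> {}" "V \<noteq> UNIV" using V(1) Suc.prems by auto
    then obtain x y where xy: "x \<in> V" "y \<notin> V" "{x, y} \<in> T"
      using connected_graph_crossing_edge[OF conn] by (metis UNIV_eq_I ex_in_conv)
    have "e = {x, y}" if e: "e \<in> T" "e \<subseteq> insert y V" "\<not> e \<subseteq> V" for e
    proof (rule ccontr)
      assume "e \<noteq> {x, y}"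
      obtain z where z: "e = {y, z}" "z \<in> V"
        using e two[OF e(1)] unfolding card_2_iff by blast
      with \<open>e \<noteq> {x, y}\<close> have "z \<noteq> x" by (auto simp: insert_commute)
      obtain vs where vs: "vs \<noteq> []" "hd vs = z" "last vs = x" "distinct vs" "set vs \<subseteq> V"
        "successively (\<lambda>a b. {a, b} \<in> {e \<in> T. e \<subseteq> V}) vs"
        using leaf_grown_simple_path[OF V(2) z(2) xy(1)] by blast
      have "length vs \<ge> 2" using vs(1-3) \<open>z \<noteq> x\<close>
        by (cases vs; cases "tl vs") auto
      moreover have "successively (\<lambda>a b. {a, b} \<in> T) vs"
        using vs(6) by (rule successively_mono) auto
      ultimately have "graph_cycle T (vs @ [y])"
        using vs z xy e by (intro graph_cycle_of_path) auto
      then show False using acyc by blast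
    qed
    then have "{e \<in> T. e \<subseteq> insert y V} \<subseteq> insert {x, y} {e \<in> T. e \<subseteq> V}" by blast
    moreover have "insert {x, y} {e \<in> T. e \<subseteq> V} \<subseteq> {e \<in> T. e \<subseteq> insert y V}"
      using xy by blast
    ultimately have "{e \<in> T. e \<subseteq> insert y V} = insert {x, y} {e \<in> T. e \<subseteq> V}"
      by (rule equalityI)
    then have "leaf_grown (insert y V) {e \<in> T. e \<subseteq> insert y V}"
      using leaf_grown.leaf[OF V(2) xy(1,2)] by simp
    moreover have "card (insert y V) = Suc k + 2" using V xy by simp
    ultimately show ?case by blast
  qed
  moreover obtain k where "CARD('n) = k + 2" using n by (metis le_iff_add add.commute)
  ultimately obtain V where "card V = CARD('n)" "leaf_grown V {e \<in> T. e \<subseteq> V}"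
    by (metis order_refl)
  moreover then have "V = UNIV" by (simp add: card_eq_UNIV_imp_eq_UNIV)
  ultimately show ?thesis by simp
qed

lemma is_cover_graph_complement:
  "is_cover (graph_complement T) C \<longleftrightarrow> (\<forall>i j. i \<notin> C \<longrightarrow> j \<notin> C \<longrightarrow> i \<noteq> j \<longrightarrow> {i, j} \<in> T)"
proof -
  have "is_cover (graph_complement T) C \<longleftrightarrow> (\<forall>i j. i \<noteq> j \<and> {i, j} \<notin> T \<longrightarrow> C \<inter> {i, j} \<noteq> {})"
    unfolding is_cover_def graph_complement_def by blast
  also have "\<dots> \<longleftrightarrow> (\<forall>i j. i \<notin> C \<longrightarrow> j \<notin> C \<longrightarrow> i \<noteq> j \<longrightarrow> {i, j} \<in> T)"
    by auto
  finally show ?thesis .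
qed

lemma tree_triangle_free:
  assumes "is_tree T" "{a, b} \<in> T" "{b, c} \<in> T" "{c, a} \<in> T"
  shows False
proof -
  have "a \<noteq> b" "b \<noteq> c" "c \<noteq> a"
    using assms by (auto simp: is_tree_def simple_graph_def)
  then have "graph_cycle T ([a, b] @ [c])"
    using assms by (intro graph_cycle_of_path) auto
  then show False using assms(1) unfolding is_tree_def by blast
qed

text \<open>
  Minimal covers are the complements of maximal cliques of \<open>T\<close>, and these are the edges: a clique
  with at most one vertex extends to an edge, and one with three vertices would be a triangle.
\<close>

lemma minimal_cover_complement_of_tree:
  fixes T :: "'n::finite set set"
  assumes T: "is_tree T" and n: "CARD('n) \<ge> 2"
  shows "is_minimal_cover (graph_complement T) C \<longleftrightarrow> - C \<in> T"
proof
  assume min: "is_minimal_cover (graph_complement T) C"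
  have clique: "{i, j} \<in> T" if "i \<notin> C" "j \<notin> C" "i \<noteq> j" for i j
    using min that unfolding is_minimal_cover_def is_cover_graph_complement by blast
  have max: "\<not> is_cover (graph_complement T) (C - {l})" if "l \<in> C" for l
    using min that unfolding is_minimal_cover_def by blast
  have "C \<noteq> UNIV" using max unfolding is_cover_graph_complement by blast
  then obtain a where a: "a \<notin> C" by blast
  obtain e where e: "e \<in> T" "a \<in> e"
    using leaf_grown_no_isolated[OF tree_leaf_grown[OF T n]] by blast
  moreover have "card e = 2" using e T by (simp add: is_tree_def simple_graph_def)
  ultimately obtain b where b: "e = {a, b}" "a \<noteq> b" by (auto simp: card_2_iff)
  have "- C \<noteq> {a}"
  proof
    assume "- C = {a}"
    then have only_a: "i \<notin> C \<longleftrightarrow> i = a" for i by blast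
    have out: "i = a \<or> i = b" if "i \<notin> C - {b}" for i using that only_a[of i] by simp
    have ab: "{a, b} \<in> T" "{b, a} \<in> T" using e(1) b by (simp_all add: insert_commute)
    have "is_cover (graph_complement T) (C - {b})"
      unfolding is_cover_graph_complement
    proof (intro allI impI)
      fix i j assume ij: "i \<notin> C - {b}" "j \<notin> C - {b}" "i \<noteq> j"
      consider "i = a" "j = b" | "i = b" "j = a"
        using out[OF ij(1)] out[OF ij(2)] ij(3) by blast
      then show "{i, j} \<in> T" by cases (simp_all only: ab)
    qed
    moreover have "b \<in> C" using only_a[of b] b(2) by metis
    ultimately show False using max[of b] by simp
  qed
  then obtain c where c: "c \<notin> C" "c \<noteq> a" using a by blast
  have "d = a \<or> d = c" if "d \<notin> C" for d
    using tree_triangle_free[OF T, of a c d] clique[of a c] clique[of c d] clique[of d a] a c that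
    by blast
  then have "- C = {a, c}" using a c by blast
  then show "- C \<in> T" using clique a c by simp
next
  assume C: "- C \<in> T"
  then have "card (- C) = 2" using T by (simp add: is_tree_def simple_graph_def)
  then obtain a b where ab: "- C = {a, b}" "a \<noteq> b" by (auto simp: card_2_iff)
  then have nC: "i \<notin> C \<longleftrightarrow> i = a \<or> i = b" for i by blast
  have "is_cover (graph_complement T) C"
  proof -
    have "{a, b} \<in> T" "{b, a} \<in> T" using C ab by (simp_all add: insert_commute)
    then show ?thesis unfolding is_cover_graph_complement nC by metis
  qed
  moreover have "\<not> is_cover (graph_complement T) (C - {l})" if "l \<in> C" for l
  proof
    assume "is_cover (graph_complement T) (C - {l})"
    then have clique: "{i, j} \<in> T" if "i \<notin> C - {l}" "j \<notin> C - {l}" "i \<noteq> j" for i j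
      using that unfolding is_cover_graph_complement by simp
    have "b \<notin> C" "a \<notin> C" using nC by simp_all
    then have "{b, l} \<in> T" "{l, a} \<in> T"
      using clique[of b l] clique[of l a] \<open>l \<in> C\<close> by auto
    then show False using tree_triangle_free[OF T, of a b l] C ab by simp
  qed
  ultimately show "is_minimal_cover (graph_complement T) C"
    unfolding is_minimal_cover_def by blast
qed

section \<open>Counting monomials\<close>

text \<open>
  An edge \<open>e\<close> stands for the generator of \<open>J\<close> in which exactly the variables outside \<open>e\<close> occur. A
  product of \<open>s\<close> generators therefore contains the variable of \<open>w\<close> once for every edge that misses
  \<open>w\<close>, and the vectors \<open>m\<close> below are the exponents of its multiples.
\<close>

definition admissible :: "'n set \<Rightarrow> 'n set set \<Rightarrow> nat \<Rightarrow> ('n \<Rightarrow> nat) \<Rightarrow> bool" where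
  "admissible V E s m \<longleftrightarrow>
     (\<exists>es. set_mset es \<subseteq> E \<and> size es = s \<and> (\<forall>w\<in>V. size {#e \<in># es. w \<notin> e#} \<le> m w))"

definition admissible_vectors :: "'n set \<Rightarrow> 'n set set \<Rightarrow> nat \<Rightarrow> nat \<Rightarrow> ('n \<Rightarrow> nat) set" where
  "admissible_vectors V E s d =
     {m. (\<forall>w. w \<notin> V \<longrightarrow> m w = 0) \<and> (\<Sum>w\<in>V. m w) = d \<and> admissible V E s m}"

lemma filter_replicate_mset:
  "{#y \<in># replicate_mset n x. P y#} = (if P x then replicate_mset n x else {#})"
  by (induction n) simp_all

text \<open>
  Among all multisets of edges that witness the left-hand side, one with the fewest copies of \<open>{u, v}\<close>
  has exactly \<open>s - m v\<close> of them (truncated subtraction), by the exchange with another edge at \<open>u\<close>.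
  Removing these copies gives the right-hand side; adding them back gives the converse.
\<close>

lemma admissible_leaf:
  assumes V: "u \<in> V" "v \<notin> V" and E: "\<And>e. e \<in> E \<Longrightarrow> e \<subseteq> V" and nbr: "\<exists>e\<in>E. u \<in> e"
  shows "admissible (insert v V) (insert {u, v} E) s m \<longleftrightarrow>
     (\<forall>w\<in>V - {u}. s - m v \<le> m w)
     \<and> admissible V E (min s (m v)) (\<lambda>w. if w = u then m w else m w - (s - m v))"
  (is "?L \<longleftrightarrow> ?R")
proof
  let ?uv = "{u, v}"
  let ?k = "s - m v"
  define ok where "ok es \<longleftrightarrow> set_mset es \<subseteq> insert ?uv E \<and> size es = s
      \<and> (\<forall>w\<in>insert v V. size {#e \<in># es. w \<notin> e#} \<le> m w)" for es
  have uvE: "?uv \<notin> E" using V(2) E[of ?uv] by auto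
  assume ?L
  then obtain es0 where "ok es0" unfolding admissible_def ok_def[symmetric] by blast
  then obtain es where ok: "ok es" and least: "\<And>es'. ok es' \<Longrightarrow> count es ?uv \<le> count es' ?uv"
    using ex_has_least_nat[of ok es0 "\<lambda>es. count es ?uv"] by blast
  note okD = ok[unfolded ok_def]
  note es = conjunct1[OF okD] conjunct1[OF conjunct2[OF okD]]
    bspec[OF conjunct2[OF conjunct2[OF okD]]]
  define es' where "es' = {#e \<in># es. e \<noteq> ?uv#}"
  have split: "replicate_mset (count es ?uv) ?uv + es' = es"
    unfolding es'_def filter_eq_replicate_mset[symmetric] by (rule multiset_partition[symmetric])
  have es'E: "set_mset es' \<subseteq> E" using es(1) unfolding es'_def by auto
  have miss_v: "{#e \<in># es. v \<notin> e#} = es'"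
    unfolding es'_def
  proof (rule filter_mset_cong[OF refl])
    fix e assume "e \<in># es"
    then have "e = ?uv \<or> e \<in> E" using es(1) by auto
    then show "v \<notin> e \<longleftrightarrow> e \<noteq> ?uv" using V(2) E[of e] by auto
  qed
  have size_s: "s = count es ?uv + size es'"
    using arg_cong[OF split, of size] es(2) by (simp del: size_eq_0_iff_empty)
  have size_es': "size es' \<le> m v" using es(3)[of v] miss_v by simp
  have count_k: "count es ?uv = ?k"
  proof (rule ccontr)
    assume "count es ?uv \<noteq> ?k"
    with size_es' size_s have lt: "size es' < m v" "count es ?uv > 0" by linarith+
    obtain f where f: "f \<in> E" "u \<in> f" using nbr by blast
    \<comment> \<open>Exchange one copy of \<open>{u, v}\<close> for an edge \<open>f\<close> at \<open>u\<close>. Only \<open>v\<close> is missed more often, by one.\<close>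
    define rest where "rest = es - {#?uv#}"
    have es_eq: "es = add_mset ?uv rest" using lt(2) unfolding rest_def by simp
    define fs where fs_eq: "fs = add_mset f rest"
    have "ok fs"
      unfolding ok_def
    proof (intro conjI ballI)
      show "set_mset fs \<subseteq> insert ?uv E" using es(1) f unfolding es_eq fs_eq by auto
      show "size fs = s" using es(2) unfolding es_eq fs_eq by simp
      fix w assume w: "w \<in> insert v V"
      show "size {#e \<in># fs. w \<notin> e#} \<le> m w"
      proof (cases "w = v")
        case True
        have "size {#e \<in># fs. v \<notin> e#} \<le> Suc (size {#e \<in># rest. v \<notin> e#})"
          by (simp add: fs_eq)
        also have "{#e \<in># rest. v \<notin> e#} = {#e \<in># es. v \<notin> e#}"
          by (simp add: es_eq)
        finally show ?thesis using miss_v lt(1) True by simp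
      next
        case False
        then have "size {#e \<in># fs. w \<notin> e#} \<le> size {#e \<in># es. w \<notin> e#}"
          using f(2) by (auto simp: fs_eq es_eq)
        also have "\<dots> \<le> m w" using es(3)[OF w] .
        finally show ?thesis .
      qed
    qed
    then have "count es ?uv \<le> count fs ?uv" by (rule least)
    moreover have "f \<noteq> ?uv" using uvE f(1) by blast
    ultimately show False by (simp add: es_eq fs_eq)
  qed
  have miss: "size {#e \<in># es. w \<notin> e#} = (if w \<in> ?uv then 0 else ?k) + size {#e \<in># es'. w \<notin> e#}"
    for w
  proof -
    have "es = replicate_mset ?k ?uv + es'" using split[symmetric] unfolding count_k .
    then show ?thesis by (cases "w \<in> ?uv") (simp_all add: filter_replicate_mset)
  qed
  have "size es' = min s (m v)" using size_s count_k by auto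
  moreover have low: "?k + size {#e \<in># es'. w \<notin> e#} \<le> m w" if "w \<in> V - {u}" for w
    using es(3)[of w] miss[of w] that V(2) by (auto split: if_splits)
  moreover have "size {#e \<in># es'. u \<notin> e#} \<le> m u"
    using es(3)[of u] miss[of u] V(1) by simp
  ultimately have "size {#e \<in># es'. w \<notin> e#} \<le> (if w = u then m w else m w - ?k)" if "w \<in> V" for w
  proof (cases "w = u")
    case False
    then show ?thesis using low[of w] that by simp
  qed simp
  moreover have "?k \<le> m w" if "w \<in> V - {u}" for w using low[OF that] by simp
  ultimately show ?R
    using es'E \<open>size es' = min s (m v)\<close> unfolding admissible_def by blast
next
  assume ?R
  let ?k = "s - m v"
  from \<open>?R\<close> obtain es where low: "\<forall>w\<in>V - {u}. ?k \<le> m w"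
    and es: "set_mset es \<subseteq> E" "size es = min s (m v)"
    "\<And>w. w \<in> V \<Longrightarrow> size {#e \<in># es. w \<notin> e#} \<le> (if w = u then m w else m w - ?k)"
    unfolding admissible_def by blast
  let ?fs = "replicate_mset ?k {u, v} + es"
  have "size {#e \<in># ?fs. w \<notin> e#} \<le> m w" if "w \<in> insert v V" for w
  proof (cases "w = v")
    case True
    have "size {#e \<in># es. v \<notin> e#} \<le> size es" by (rule size_filter_mset_lesseq)
    then show ?thesis using True es(2) by (simp add: filter_replicate_mset)
  next
    case False
    then have w: "w \<in> V" using that by blast
    show ?thesis
    proof (cases "w = u")
      case True
      then show ?thesis using es(3)[OF w] by (simp add: filter_replicate_mset)
    next
      case neq: False
      then have "?k \<le> m w" using low w by blast
      then show ?thesis using es(3)[OF w] neq False by (simp add: filter_replicate_mset)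
    qed
  qed
  then show ?L unfolding admissible_def using es
    by (intro exI[of _ ?fs]) auto
qed

text \<open>
  The number of admissible vectors of degree \<open>d\<close> for a tree with \<open>j + 2\<close> vertices. In the recursive
  equation \<open>a\<close> is the exponent at the leaf, and \<open>s - a\<close> is the cost at each of the \<open>Suc j\<close> vertices
  that are neither the leaf nor its neighbour.
\<close>

fun leaf_count :: "nat \<Rightarrow> nat \<Rightarrow> nat \<Rightarrow> nat" where
  "leaf_count 0 s d = Suc d"
| "leaf_count (Suc j) s d =
     (\<Sum>a\<le>d. if a + (s - a) * Suc j \<le> d
             then leaf_count j (min s a) (d - (a + (s - a) * Suc j)) else 0)"

lemma finite_admissible_vectors:
  assumes "finite V"
  shows "finite (admissible_vectors V E s d)"
proof (rule finite_subset)
  show "admissible_vectors V E s d \<subseteq> {m. \<forall>w. (w \<in> V \<longrightarrow> m w \<in> {..d}) \<and> (w \<notin> V \<longrightarrow> m w = 0)}"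
    using assms by (auto simp: admissible_vectors_def intro: member_le_sum)
  show "finite {m :: 'a \<Rightarrow> nat. \<forall>w. (w \<in> V \<longrightarrow> m w \<in> {..d}) \<and> (w \<notin> V \<longrightarrow> m w = 0)}"
    by (rule finite_set_of_finite_funs[OF assms]) simp
qed

text \<open>A single edge misses no vertex, so every vector is admissible.\<close>

lemma card_admissible_vectors_edge:
  assumes "a \<noteq> b"
  shows "card (admissible_vectors {a, b} {{a, b}} s d) = Suc d"
proof -
  have adm: "admissible {a, b} {{a, b}} s m" for m
    unfolding admissible_def
    by (intro exI[of _ "replicate_mset s {a, b}"]) (auto simp: filter_replicate_mset)
  have "bij_betw (\<lambda>m. m a) (admissible_vectors {a, b} {{a, b}} s d) {..d}"
  proof (rule bij_betwI[where g = "\<lambda>i w. if w = a then i else if w = b then d - i else 0"])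
    show "(\<lambda>m. m a) \<in> admissible_vectors {a, b} {{a, b}} s d \<rightarrow> {..d}"
      using assms by (auto simp: admissible_vectors_def)
    show "(\<lambda>i w. if w = a then i else if w = b then d - i else 0)
        \<in> {..d} \<rightarrow> admissible_vectors {a, b} {{a, b}} s d"
      using assms by (auto simp: admissible_vectors_def adm)
  qed (use assms in \<open>auto simp: admissible_vectors_def fun_eq_iff\<close>)
  then show ?thesis by (simp add: bij_betw_same_card)
qed

text \<open>
  The vectors are sorted by their value \<open>a\<close> at the leaf. Those with a fixed \<open>a\<close> correspond to the
  admissible vectors of the smaller tree by adding \<open>s - a\<close> at all old vertices except \<open>u\<close>.
\<close>

lemma card_admissible_vectors_leaf:
  assumes "finite V" and V: "u \<in> V" "v \<notin> V" and E: "\<And>e. e \<in> E \<Longrightarrow> e \<subseteq> V"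
    and nbr: "\<exists>e\<in>E. u \<in> e"
  shows "card (admissible_vectors (insert v V) (insert {u, v} E) s d) =
     (\<Sum>a\<le>d. if a + (s - a) * (card V - 1) \<le> d
             then card (admissible_vectors V E (min s a) (d - (a + (s - a) * (card V - 1)))) else 0)"
proof -
  let ?M = "admissible_vectors (insert v V) (insert {u, v} E) s d"
  let ?c = "\<lambda>a. (s - a) * (card V - 1)"
  have "?M = (\<Union>a\<le>d. {m \<in> ?M. m v = a})"
    using assms by (auto simp: admissible_vectors_def)
  then have "card ?M = card (\<Union>a\<le>d. {m \<in> ?M. m v = a})" by simp
  also have "\<dots> = (\<Sum>a\<le>d. card {m \<in> ?M. m v = a})"
    using assms by (intro card_UN_disjoint) (auto intro: finite_subset[OF _ finite_admissible_vectors])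
  also have "\<dots> = (\<Sum>a\<le>d. if a + ?c a \<le> d
      then card (admissible_vectors V E (min s a) (d - (a + ?c a))) else 0)"
  proof (rule sum.cong[OF refl])
    fix a assume "a \<in> {..d}"
    let ?k = "s - a"
    define up where "up m = (\<lambda>w. if w = v then a else if w \<in> V - {u} then m w + ?k else m w)"
      for m :: "'a \<Rightarrow> nat"
    define down where "down m = (\<lambda>w. if w = v then 0 else if w \<in> V - {u} then m w - ?k else m w)"
      for m :: "'a \<Rightarrow> nat"
    have sum_up: "(\<Sum>w\<in>insert v V. up m w) = a + ?c a + (\<Sum>w\<in>V. m w)" for m
    proof -
      have "(\<Sum>w\<in>V. up m w) = up m u + (\<Sum>w\<in>V - {u}. up m w)"
        using assms by (simp add: sum.remove)
      also have "(\<Sum>w\<in>V - {u}. up m w) = (\<Sum>w\<in>V - {u}. m w + ?k)"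
        using V by (intro sum.cong) (auto simp: up_def)
      also have "up m u = m u" using V by (auto simp: up_def)
      also have "m u + (\<Sum>w\<in>V - {u}. m w + ?k) = ?c a + (\<Sum>w\<in>V. m w)"
        using assms by (simp add: sum.remove[of V u] sum.distrib)
      finally show ?thesis using assms by (simp add: up_def)
    qed
    have adm_up: "admissible (insert v V) (insert {u, v} E) s (up m) \<longleftrightarrow> admissible V E (min s a) m" for m
    proof -
      have "admissible V E t (\<lambda>w. if w = u then up m w else up m w - ?k) = admissible V E t m" for t
        unfolding admissible_def using V by (auto simp: up_def)
      moreover have up_v: "up m v = a" by (simp add: up_def)
      moreover have "\<forall>w\<in>V - {u}. s - a \<le> up m w" using V by (auto simp: up_def)
      ultimately show ?thesis
        using admissible_leaf[OF V E nbr, of s "up m", unfolded up_v] by simp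
    qed
    have up_down: "up (down m) = m" if "m \<in> ?M" "m v = a" for m
      using that V admissible_leaf[OF V E nbr, of s m]
      by (auto simp: up_def down_def admissible_vectors_def fun_eq_iff)
    have "{m \<in> ?M. m v = a} = up ` {m. (\<forall>w. w \<notin> V \<longrightarrow> m w = 0)
        \<and> a + ?c a + (\<Sum>w\<in>V. m w) = d \<and> admissible V E (min s a) m}" (is "_ = up ` ?N")
    proof (intro equalityI subsetI)
      fix m assume m: "m \<in> {m \<in> ?M. m v = a}"
      then have *: "up (down m) = m" using up_down by blast
      have "a + ?c a + (\<Sum>w\<in>V. down m w) = d"
        using m sum_up[of "down m"] by (simp add: * admissible_vectors_def)
      moreover have "admissible V E (min s a) (down m)"
        using m adm_up[of "down m"] by (simp add: * admissible_vectors_def)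
      moreover have "\<forall>w. w \<notin> V \<longrightarrow> down m w = 0"
        using m by (auto simp: admissible_vectors_def down_def)
      ultimately have "down m \<in> ?N" by blast
      then have "up (down m) \<in> up ` ?N" by (rule imageI)
      then show "m \<in> up ` ?N" unfolding * .
    next
      fix m assume "m \<in> up ` ?N"
      then obtain m' where m': "m = up m'" "m' \<in> ?N" by blast
      then show "m \<in> {m \<in> ?M. m v = a}"
        using sum_up[of m'] adm_up[of m'] V by (simp add: admissible_vectors_def) (simp add: up_def)
    qed
    moreover have "inj_on up ?N"
    proof (rule inj_on_inverseI[where g = down])
      fix m assume "m \<in> ?N"
      then show "down (up m) = m" using V by (auto simp: up_def down_def fun_eq_iff)
    qed
    ultimately have "card {m \<in> ?M. m v = a} = card ?N" by (simp add: card_image)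
    also have "?N = (if a + ?c a \<le> d then admissible_vectors V E (min s a) (d - (a + ?c a)) else {})"
      by (auto simp: admissible_vectors_def)
    finally show "card {m \<in> ?M. m v = a} = (if a + ?c a \<le> d
        then card (admissible_vectors V E (min s a) (d - (a + ?c a))) else 0)" by simp
  qed
  finally show ?thesis .
qed

lemma card_admissible_vectors:
  assumes "leaf_grown V E"
  shows "card V \<ge> 2 \<and> card (admissible_vectors V E s d) = leaf_count (card V - 2) s d"
  using assms
proof (induction arbitrary: s d rule: leaf_grown.induct)
  case (edge a b)
  then show ?case by (simp add: card_admissible_vectors_edge)
next
  case (leaf V E u v)
  obtain j where j: "card V = j + 2" using leaf.IH by (metis le_iff_add add.commute)
  have "card (insert v V) = Suc j + 2"
    using j leaf leaf_grown_finite by fastforce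
  moreover have "card (admissible_vectors (insert v V) (insert {u, v} E) s d) = leaf_count (Suc j) s d"
    using card_admissible_vectors_leaf[OF leaf_grown_finite[OF leaf.hyps(1)] leaf.hyps(2,3)
        leaf_grown_edge_subset[OF leaf.hyps(1)] leaf_grown_no_isolated[OF leaf.hyps(1,2)]]
    by (simp add: leaf.IH j cong: if_cong)
  ultimately show ?case by simp
qed

section \<open>The Hilbert series\<close>

lemma hilbert_series_cover_ideal_power:
  fixes T :: "'n::finite set set"
  assumes T: "is_tree T" and n: "CARD('n) \<ge> 2"
  shows "hilbert_series (ideal_power (cover_ideal (graph_complement T) :: ('n, 'k::field) mpoly set) s)
     = Abs_fps (\<lambda>d. int (leaf_count (CARD('n) - 2) s d))"
proof -
  define g :: "'n set \<Rightarrow> 'n \<Rightarrow>\<^sub>0 nat" where "g e = (\<Sum>i\<in>- e. Poly_Mapping.single i 1)" for e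
  define U where "U = {sum_mset (image_mset g es) + b | es b. set_mset es \<subseteq> T \<and> size es = s}"
  have lookup_g: "Poly_Mapping.lookup (g e) w = (if w \<in> e then 0 else 1)" for e w
    by (simp add: g_def lookup_sum lookup_single when_def)
  have lookup_gs: "Poly_Mapping.lookup (sum_mset (image_mset g es)) w = size {#e \<in># es. w \<notin> e#}" for es w
    by (induction es) (auto simp: lookup_add lookup_g)
  have prod_var: "(\<Prod>i\<in>- e. var i) = Poly_Mapping.single (g e) (1::'k)" for e
    unfolding var_def prod_monomials g_def ..
  have "{\<Prod>i\<in>C. var i | C. is_minimal_cover (graph_complement T) C}
      = {\<Prod>i\<in>- e. var i | e. e \<in> T}"
    unfolding minimal_cover_complement_of_tree[OF T n] by (metis double_complement)
  also have "\<dots> = (\<lambda>e. Poly_Mapping.single (g e) (1::'k)) ` T"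
    unfolding prod_var by blast
  finally have generators: "{\<Prod>i\<in>C. var i | C. is_minimal_cover (graph_complement T) C}
      = (\<lambda>e. Poly_Mapping.single (g e) (1::'k)) ` T" .
  have power: "ideal_power (cover_ideal (graph_complement T)) s = {p :: ('n, 'k) mpoly. Poly_Mapping.keys p \<subseteq> U}"
    unfolding cover_ideal_def U_def generators ideal_power_monomials ..
  have mem_U: "m \<in> U \<longleftrightarrow> admissible UNIV T s (Poly_Mapping.lookup m)" for m
  proof
    assume "m \<in> U"
    then obtain es b where m: "m = sum_mset (image_mset g es) + b"
      and es: "set_mset es \<subseteq> T" "size es = s"
      unfolding U_def by blast
    have "size {#e \<in># es. w \<notin> e#} \<le> Poly_Mapping.lookup m w" for w
      by (simp add: m lookup_add lookup_gs)
    then show "admissible UNIV T s (Poly_Mapping.lookup m)"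
      unfolding admissible_def using es by blast
  next
    assume "admissible UNIV T s (Poly_Mapping.lookup m)"
    then obtain es where es: "set_mset es \<subseteq> T" "size es = s"
      and le: "\<And>w. size {#e \<in># es. w \<notin> e#} \<le> Poly_Mapping.lookup m w"
      unfolding admissible_def by blast
    have "m = sum_mset (image_mset g es) + (m - sum_mset (image_mset g es))"
      using le by (intro poly_mapping_eqI) (simp add: lookup_add lookup_minus lookup_gs)
    then show "m \<in> U" unfolding U_def using es by blast
  qed
  have dim: "vector_space.dim mpoly_scale
      (homogeneous_component (ideal_power (cover_ideal (graph_complement T) :: ('n, 'k) mpoly set) s) d)
      = card (admissible_vectors UNIV T s d)" for d
  proof -
    let ?K = "Poly_Mapping.lookup -` admissible_vectors UNIV T s d :: ('n \<Rightarrow>\<^sub>0 nat) set"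
    have inj: "inj (Poly_Mapping.lookup :: ('n \<Rightarrow>\<^sub>0 nat) \<Rightarrow> _)"
      by (rule injI) (simp add: poly_mapping_eqI)
    have surj: "range (Poly_Mapping.lookup :: ('n \<Rightarrow>\<^sub>0 nat) \<Rightarrow> _) = UNIV"
      by (rule surjI[where f = Abs_poly_mapping]) (rule Abs_poly_mapping_inverse, simp)
    have "m \<in> ?K \<longleftrightarrow> m \<in> U \<and> (\<Sum>i\<in>UNIV. Poly_Mapping.lookup m i) = d" for m
      by (auto simp: mem_U admissible_vectors_def)
    then have "homogeneous_component (ideal_power (cover_ideal (graph_complement T)) s) d
        = {p :: ('n, 'k) mpoly. Poly_Mapping.keys p \<subseteq> ?K}"
      unfolding homogeneous_component_def power by blast
    moreover have "finite ?K"
      using inj by (intro finite_vimageI finite_admissible_vectors) simp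
    moreover have "card ?K = card (admissible_vectors UNIV T s d)"
      using inj surj by (intro card_vimage_inj) simp_all
    ultimately show ?thesis by (simp only: dim_supported_on)
  qed
  show ?thesis
    unfolding hilbert_series_def dim
    using card_admissible_vectors[OF tree_leaf_grown[OF T n]] by simp
qed

theorem lemma3p11:
  fixes T1 T2 :: "'n::finite set set"
    and J1 J2 :: "('n, 'k::field) mpoly set"
    and s :: nat
  assumes "is_tree T1" and "is_tree T2"
    and "J1 = cover_ideal (graph_complement T1)"
    and "J2 = cover_ideal (graph_complement T2)"
    and "s \<ge> 1"
  shows "hilbert_series (ideal_power J1 s) = hilbert_series (ideal_power J2 s)"
proof (cases "CARD('n) \<ge> 2")
  case True
  then show ?thesis
    unfolding assms(3,4) using assms(1,2) by (simp add: hilbert_series_cover_ideal_power)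
next
  case False
  \<comment> \<open>With a single vertex there are no two-element sets of vertices, hence no edges.\<close>
  have "T = {}" if "is_tree T" for T :: "'n set set"
  proof -
    have "card e \<noteq> 2" for e :: "'n set"
      using False card_mono[of UNIV e] by auto
    then show ?thesis using that by (auto simp: is_tree_def simple_graph_def)
  qed
  then have "T1 = T2" using assms(1,2) by metis
  then show ?thesis using assms(3,4) by simp
qed

end
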